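(* Let $(S,\mathcal{S},\mu)$ be a measure space, and $\eta$ a random measure on $S$ that is $\mu$-swap-invariant under a probability measure $\mathbf{Q}$. Further let $X$ be a random variable with $X>0$ $\mathbf{Q}$-almost surely and $\mathbf{E}_{\mathbf{Q}}[X^{-1}]<\infty$, and let $\mathbf{P}$ be another probability measure defined by $$\frac{\mathrm{d}\mathbf{P}}{\mathrm{d}\mathbf{Q}}=\frac{1}{X\,\mathbf{E}_{\mathbf{Q}}[X^{-1}]}.$$ Then the random measure $\xi$ defined by $\xi=X\eta$ is $\mu$-swap-invariant under $\mathbf{P}$.
   Context: A random measure $\xi$ on a measurable space $(S,\mathcal{S})$, defined over a probability space, is a map $\xi:\Omega\times\mathcal{S}\to[0,\infty]$ such that $\xi(M)=\xi(\cdot,M)$ is measurable for each $M\in\mathcal{S}$ and $\xi(\omega,\cdot)$ is a measure for each $\omega\in\Omega$. On the null event $\{X\le 0\}$ one sets $\xi=0$. $\mu$-swap-invariant: $\mathbf{E}\,\big|\sum_{j=1}^n u_j\xi(A_j)\big|=\mathbf{E}\,\big|\sum_{j=1}^n u_j\xi(B_j)\big|$ for all $n\ge1$, $u\in\mathbb{R}^n$, disjoint $A_1,\dots,A_n\in\mathcal{S}$ and disjoint $B_1,\dots,B_n\in\mathcal{S}$ such that $\mu(A_j)=\mu(B_j)$, $\mathbf{E}\,\xi(A_j)<\infty$ and $\mathbf{E}\,\xi(B_j)<\infty$ for $1\le j\le n$; "under $\mathbf{Q}$" means that all expectations are taken with respect to $\mathbf{Q}$. *)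

theory Defs
  imports "HOL-Probability.Probability"
begin

(* A random measure on (space M, sets M) defined over N. Only the measurable space underlying M
   matters here, not its measure; the values need not be sigma-finite. *)
definition random_measure :: "'w measure \<Rightarrow> 's measure \<Rightarrow> ('w \<Rightarrow> 's measure) \<Rightarrow> bool" where
  "random_measure N M \<xi> \<longleftrightarrow>
     (\<forall>\<omega>\<in>space N. sets (\<xi> \<omega>) = sets M) \<and>
     (\<forall>A\<in>sets M. (\<lambda>\<omega>. emeasure (\<xi> \<omega>) A) \<in> borel_measurable N)"

(* Swap-invariance of \<xi> with respect to the measure M, all expectations being taken under N.
   Expectations of nonnegative quantities are nonnegative Lebesgue integrals, so they never take
   a default value. Inside the absolute value the real-valued "measure" is used: it differs from
   "emeasure" only where \<xi>(A_j) is infinite, which is a null event as \<xi>(A_j) has finite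
   expectation. *)
definition swap_invariant :: "'w measure \<Rightarrow> 's measure \<Rightarrow> ('w \<Rightarrow> 's measure) \<Rightarrow> bool" where
  "swap_invariant N M \<xi> \<longleftrightarrow>
     (\<forall>(n::nat) (u :: nat \<Rightarrow> real) (A :: nat \<Rightarrow> 's set) (B :: nat \<Rightarrow> 's set).
        n \<ge> 1 \<longrightarrow>
        A ` {1..n} \<subseteq> sets M \<longrightarrow> disjoint_family_on A {1..n} \<longrightarrow>
        B ` {1..n} \<subseteq> sets M \<longrightarrow> disjoint_family_on B {1..n} \<longrightarrow>
        (\<forall>j\<in>{1..n}. emeasure M (A j) = emeasure M (B j) \<and>
           (\<integral>\<^sup>+\<omega>. emeasure (\<xi> \<omega>) (A j) \<partial>N) < \<infinity> \<and>
           (\<integral>\<^sup>+\<omega>. emeasure (\<xi> \<omega>) (B j) \<partial>N) < \<infinity>) \<longrightarrow>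
        (\<integral>\<^sup>+\<omega>. ennreal \<bar>\<Sum>j=1..n. u j * measure (\<xi> \<omega>) (A j)\<bar> \<partial>N) =
        (\<integral>\<^sup>+\<omega>. ennreal \<bar>\<Sum>j=1..n. u j * measure (\<xi> \<omega>) (B j)\<bar> \<partial>N))"

end

theory Submission
  imports Defs
begin

(* The density cancels the factor X: E_P[X g] = E_Q[g] / E_Q[1/X] for every g \<ge> 0. Taking for g
   first \<eta>(A_j), then the absolute value of a linear combination of the \<eta>(A_j), shows that both
   the finiteness conditions and the identity that define swap-invariance hold for \<xi> under P
   exactly when they hold for \<eta> under Q. *)

text \<open>A nonnegative integrable function with integral 0 vanishes almost everywhere, whereas
  \<open>1 / X\<close> is nonzero wherever \<open>X\<close> is positive. This makes division by the
  normalising constant legitimate.\<close>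

lemma (in prob_space) expectation_inverse_pos:
  fixes X :: "'a \<Rightarrow> real"
  assumes pos: "AE \<omega> in M. X \<omega> > 0" and int: "integrable M (\<lambda>\<omega>. 1 / X \<omega>)"
  shows "(\<integral>\<omega>. 1 / X \<omega> \<partial>M) > 0"
proof -
  have nonneg: "AE \<omega> in M. 0 \<le> 1 / X \<omega>"
    using pos by eventually_elim simp
  have "(\<integral>\<omega>. 1 / X \<omega> \<partial>M) \<noteq> 0"
  proof
    assume "(\<integral>\<omega>. 1 / X \<omega> \<partial>M) = 0"
    then have "AE \<omega> in M. 1 / X \<omega> = 0"
      using integral_nonneg_eq_0_iff_AE[OF int nonneg] by simp
    \<comment> \<open>Impossible, since the whole space has mass 1 and so is not a null set.\<close>
    with pos have "AE \<omega> in M. False" by eventually_elim simp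
    then show False by simp
  qed
  moreover have "(\<integral>\<omega>. 1 / X \<omega> \<partial>M) \<ge> 0"
    using nonneg by (rule integral_nonneg_AE)
  ultimately show ?thesis by simp
qed

text \<open>The normalising constant is the integral of \<open>1 / X\<close>, which is finite by
  integrability and positive by the previous lemma, so the total mass is
  \<open>c * (1 / c)\<close>.\<close>

lemma (in prob_space) prob_space_density_inverse:
  fixes X :: "'a \<Rightarrow> real"
  assumes X [measurable]: "X \<in> borel_measurable M"
    and pos: "AE \<omega> in M. X \<omega> > 0" and int: "integrable M (\<lambda>\<omega>. 1 / X \<omega>)"
  shows "prob_space (density M (\<lambda>\<omega>. ennreal (1 / (X \<omega> * (\<integral>\<omega>'. 1 / X \<omega>' \<partial>M)))))"
proof
  define c where "c = (\<integral>\<omega>. 1 / X \<omega> \<partial>M)"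
  have c: "c > 0" unfolding c_def by (rule expectation_inverse_pos[OF pos int])
  have eq: "1 / (X \<omega> * c) = (1 / X \<omega>) * (1 / c)" for \<omega> by simp
  \<comment> \<open>The constant is a Bochner integral, so the mass is computed as one too. Where
    \<open>X\<close> is negative, \<open>ennreal\<close> truncates the density to 0, but this
    happens only on a null set.\<close>
  have "(\<integral>\<^sup>+\<omega>. ennreal (1 / (X \<omega> * c)) \<partial>M) = ennreal (\<integral>\<omega>. (1 / X \<omega>) * (1 / c) \<partial>M)"
    unfolding eq
  proof (rule nn_integral_eq_integral)
    show "integrable M (\<lambda>\<omega>. (1 / X \<omega>) * (1 / c))" using int by (rule integrable_mult_left)
    show "AE \<omega> in M. 0 \<le> (1 / X \<omega>) * (1 / c)" using pos by eventually_elim (use c in simp)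
  qed
  also have "(\<integral>\<omega>. (1 / X \<omega>) * (1 / c) \<partial>M) = c * (1 / c)"
    unfolding c_def by (rule integral_mult_left_zero)
  also have "\<dots> = 1" using c by simp
  finally have 1: "(\<integral>\<^sup>+\<omega>. ennreal (1 / (X \<omega> * c)) \<partial>M) = 1" by simp
  let ?D = "density M (\<lambda>\<omega>. ennreal (1 / (X \<omega> * (\<integral>\<omega>'. 1 / X \<omega>' \<partial>M))))"
  have "emeasure ?D (space M) = (\<integral>\<^sup>+\<omega>. ennreal (1 / (X \<omega> * c)) * indicator (space M) \<omega> \<partial>M)"
    unfolding c_def by (rule emeasure_density) auto
  also have "\<dots> = (\<integral>\<^sup>+\<omega>. ennreal (1 / (X \<omega> * c)) \<partial>M)"
    by (rule nn_integral_cong) simp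
  finally show "emeasure ?D (space ?D) = 1" using 1 by simp
qed

text \<open>Under the density the factor \<open>X\<close> of \<open>f\<close> cancels, leaving the
  constant \<open>1 / c\<close>. The relation between \<open>f\<close> and \<open>g\<close> is asked
  for only where \<open>X\<close> is positive, as the rest is null; both functions may take the
  value infinity.\<close>

lemma nn_integral_density_inverse:
  fixes X :: "'a \<Rightarrow> real" and f g :: "'a \<Rightarrow> ennreal"
  assumes [measurable]: "X \<in> borel_measurable M" "f \<in> borel_measurable M" "g \<in> borel_measurable M"
    and pos: "AE \<omega> in M. X \<omega> > 0" and c: "c > 0"
    and eq: "\<And>\<omega>. \<omega> \<in> space M \<Longrightarrow> X \<omega> > 0 \<Longrightarrow> f \<omega> = ennreal (X \<omega>) * g \<omega>"
  shows "(\<integral>\<^sup>+\<omega>. f \<omega> \<partial>density M (\<lambda>\<omega>. ennreal (1 / (X \<omega> * c)))) = ennreal (1 / c) * (\<integral>\<^sup>+\<omega>. g \<omega> \<partial>M)"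
proof -
  have "(\<integral>\<^sup>+\<omega>. f \<omega> \<partial>density M (\<lambda>\<omega>. ennreal (1 / (X \<omega> * c))))
      = (\<integral>\<^sup>+\<omega>. ennreal (1 / (X \<omega> * c)) * f \<omega> \<partial>M)"
    by (rule nn_integral_density) auto
  also have "\<dots> = (\<integral>\<^sup>+\<omega>. ennreal (1 / c) * g \<omega> \<partial>M)"
  proof (rule nn_integral_cong_AE)
    show "AE \<omega> in M. ennreal (1 / (X \<omega> * c)) * f \<omega> = ennreal (1 / c) * g \<omega>"
      using pos AE_space
    proof eventually_elim
      case (elim \<omega>)
      have "ennreal (1 / (X \<omega> * c)) * f \<omega> = ennreal (1 / (X \<omega> * c)) * ennreal (X \<omega>) * g \<omega>"
        using eq[OF elim(2,1)] by (simp add: mult.assoc)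
      \<comment> \<open>The cancellation takes place among finite reals, before \<open>g\<close>
        enters.\<close>
      also have "ennreal (1 / (X \<omega> * c)) * ennreal (X \<omega>) = ennreal (1 / (X \<omega> * c) * X \<omega>)"
        using elim c by (intro ennreal_mult[symmetric]) auto
      also have "1 / (X \<omega> * c) * X \<omega> = 1 / c" using elim c by simp
      finally show ?case .
    qed
  qed
  also have "\<dots> = ennreal (1 / c) * (\<integral>\<^sup>+\<omega>. g \<omega> \<partial>M)"
    by (rule nn_integral_cmult) auto
  finally show ?thesis .
qed

theorem proposition2p11:
  fixes M :: "'s measure" and Q P :: "'w measure"
    and X :: "'w \<Rightarrow> real" and \<eta> \<xi> :: "'w \<Rightarrow> 's measure"
  assumes "prob_space Q"
    and "random_measure Q M \<eta>"
    and "swap_invariant Q M \<eta>"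
    and "X \<in> borel_measurable Q"
    and "AE \<omega> in Q. X \<omega> > 0"
    and "integrable Q (\<lambda>\<omega>. 1 / X \<omega>)"
    and "P = density Q (\<lambda>\<omega>. ennreal (1 / (X \<omega> * (\<integral>\<omega>'. 1 / X \<omega>' \<partial>Q))))"
    and "\<And>\<omega>. \<omega> \<in> space Q \<Longrightarrow>
           \<xi> \<omega> = (if X \<omega> > 0 then scale_measure (ennreal (X \<omega>)) (\<eta> \<omega>) else null_measure M)"
  shows "prob_space P \<and> random_measure P M \<xi> \<and> swap_invariant P M \<xi>"
proof -
  interpret Q: prob_space Q by fact
  note [measurable] = assms(4)
  note pos = assms(5) and P = assms(7) and \<xi> = assms(8)
  define c where "c = (\<integral>\<omega>. 1 / X \<omega> \<partial>Q)"
  have c: "c > 0" unfolding c_def by (rule Q.expectation_inverse_pos[OF assms(5,6)])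
  have prob: "prob_space P"
    unfolding P by (rule Q.prob_space_density_inverse[OF assms(4-6)])

  have sets_\<eta>: "sets (\<eta> \<omega>) = sets M" if "\<omega> \<in> space Q" for \<omega>
    using assms(2) that by (simp add: random_measure_def)
  have \<eta>_meas: "(\<lambda>\<omega>. emeasure (\<eta> \<omega>) A) \<in> borel_measurable Q" if "A \<in> sets M" for A
    using assms(2) that by (simp add: random_measure_def)
  have sets_\<xi>: "sets (\<xi> \<omega>) = sets M" if "\<omega> \<in> space Q" for \<omega>
    using that by (simp add: \<xi> sets_\<eta>)
  \<comment> \<open>This covers nonpositive \<open>X \<omega>\<close> as well: there
    \<open>ennreal (X \<omega>)\<close> is 0, and 0 times infinity is 0.\<close>
  have em_\<xi>: "emeasure (\<xi> \<omega>) A = ennreal (X \<omega>) * emeasure (\<eta> \<omega>) A" if "\<omega> \<in> space Q" for \<omega> A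
    using that by (cases "X \<omega> > 0") (simp_all add: \<xi> ennreal_neg)
  have \<xi>_meas: "(\<lambda>\<omega>. emeasure (\<xi> \<omega>) A) \<in> borel_measurable Q" if "A \<in> sets M" for A
  proof -
    note [measurable] = \<eta>_meas[OF that]
    show ?thesis by (simp add: em_\<xi> cong: measurable_cong)
  qed
  \<comment> \<open>Here the real \<open>X \<omega>\<close> is not truncated, hence the positivity
    condition. If \<open>\<eta> \<omega>\<close> gives \<open>A\<close> infinite mass, both sides
    take the default value 0.\<close>
  have me_\<xi>: "measure (\<xi> \<omega>) A = X \<omega> * measure (\<eta> \<omega>) A" if "\<omega> \<in> space Q" "X \<omega> > 0" for \<omega> A
    using that by (simp add: measure_def em_\<xi> enn2real_mult)

  have mean: "(\<integral>\<^sup>+\<omega>. emeasure (\<xi> \<omega>) A \<partial>P) = ennreal (1 / c) * (\<integral>\<^sup>+\<omega>. emeasure (\<eta> \<omega>) A \<partial>Q)"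
    if "A \<in> sets M" for A
    unfolding P c_def[symmetric]
    by (rule nn_integral_density_inverse) (use that pos c in \<open>simp_all add: \<xi>_meas \<eta>_meas em_\<xi>\<close>)
  \<comment> \<open>The factor \<open>1 / c\<close> in \<open>mean\<close> is nonzero, so a finite
    product forces the other factor to be finite.\<close>
  have finite_mean: "(\<integral>\<^sup>+\<omega>. emeasure (\<eta> \<omega>) A \<partial>Q) < \<infinity>"
    if "A \<in> sets M" "(\<integral>\<^sup>+\<omega>. emeasure (\<xi> \<omega>) A \<partial>P) < \<infinity>" for A
    using that(2) c unfolding mean[OF that(1)] by (auto simp: ennreal_mult_less_top)
  have abs_mean: "(\<integral>\<^sup>+\<omega>. ennreal \<bar>\<Sum>j=1..n. u j * measure (\<xi> \<omega>) (A j)\<bar> \<partial>P) =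
      ennreal (1 / c) * (\<integral>\<^sup>+\<omega>. ennreal \<bar>\<Sum>j=1..n. u j * measure (\<eta> \<omega>) (A j)\<bar> \<partial>Q)"
    if A: "A ` {1..n} \<subseteq> sets M" for n :: nat and u :: "nat \<Rightarrow> real" and A
    unfolding P c_def[symmetric]
  proof (rule nn_integral_density_inverse)
    have "A j \<in> sets M" if "j \<in> {1..n}" for j using A that by blast
    then have "(\<lambda>\<omega>. measure (\<xi> \<omega>) (A j)) \<in> borel_measurable Q"
      "(\<lambda>\<omega>. measure (\<eta> \<omega>) (A j)) \<in> borel_measurable Q" if "j \<in> {1..n}" for j
      using that unfolding measure_def by (auto intro!: borel_measurable_enn2real \<xi>_meas \<eta>_meas)
    then show "(\<lambda>\<omega>. ennreal \<bar>\<Sum>j=1..n. u j * measure (\<xi> \<omega>) (A j)\<bar>) \<in> borel_measurable Q"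
      "(\<lambda>\<omega>. ennreal \<bar>\<Sum>j=1..n. u j * measure (\<eta> \<omega>) (A j)\<bar>) \<in> borel_measurable Q"
      by (auto intro!: measurable_compose[OF _ measurable_ennreal] borel_measurable_abs
          borel_measurable_sum borel_measurable_times)
    fix \<omega> assume \<omega>: "\<omega> \<in> space Q" "X \<omega> > 0"
    \<comment> \<open>One scalar \<open>X \<omega>\<close> is common to all \<open>j\<close>; being
      positive, it also leaves the absolute value unchanged.\<close>
    have "(\<Sum>j=1..n. u j * measure (\<xi> \<omega>) (A j)) = X \<omega> * (\<Sum>j=1..n. u j * measure (\<eta> \<omega>) (A j))"
      by (simp add: me_\<xi>[OF \<omega>] sum_distrib_left mult.left_commute)
    then show "ennreal \<bar>\<Sum>j=1..n. u j * measure (\<xi> \<omega>) (A j)\<bar> =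
        ennreal (X \<omega>) * ennreal \<bar>\<Sum>j=1..n. u j * measure (\<eta> \<omega>) (A j)\<bar>"
      using \<omega> by (simp add: abs_mult ennreal_mult)
  qed (use pos c in simp_all)

  have "random_measure P M \<xi>"
    \<comment> \<open>A density changes neither the space nor the measurable sets, so measurability
      over \<open>Q\<close> is measurability over \<open>P\<close>.\<close>
    unfolding random_measure_def P using sets_\<xi> \<xi>_meas by simp
  moreover have "swap_invariant P M \<xi>"
    unfolding swap_invariant_def
  proof (intro allI impI)
    fix n :: nat and u :: "nat \<Rightarrow> real" and A B :: "nat \<Rightarrow> 's set"
    assume n: "n \<ge> 1" and A: "A ` {1..n} \<subseteq> sets M" and dA: "disjoint_family_on A {1..n}"
      and B: "B ` {1..n} \<subseteq> sets M" and dB: "disjoint_family_on B {1..n}"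
      and fin: "\<forall>j\<in>{1..n}. emeasure M (A j) = emeasure M (B j) \<and>
           (\<integral>\<^sup>+\<omega>. emeasure (\<xi> \<omega>) (A j) \<partial>P) < \<infinity> \<and> (\<integral>\<^sup>+\<omega>. emeasure (\<xi> \<omega>) (B j) \<partial>P) < \<infinity>"
    have "\<forall>j\<in>{1..n}. emeasure M (A j) = emeasure M (B j) \<and>
           (\<integral>\<^sup>+\<omega>. emeasure (\<eta> \<omega>) (A j) \<partial>Q) < \<infinity> \<and> (\<integral>\<^sup>+\<omega>. emeasure (\<eta> \<omega>) (B j) \<partial>Q) < \<infinity>"
      using fin A B by (blast intro: finite_mean)
    then have "(\<integral>\<^sup>+\<omega>. ennreal \<bar>\<Sum>j=1..n. u j * measure (\<eta> \<omega>) (A j)\<bar> \<partial>Q) =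
        (\<integral>\<^sup>+\<omega>. ennreal \<bar>\<Sum>j=1..n. u j * measure (\<eta> \<omega>) (B j)\<bar> \<partial>Q)"
      using assms(3) n A dA B dB unfolding swap_invariant_def by blast
    then show "(\<integral>\<^sup>+\<omega>. ennreal \<bar>\<Sum>j=1..n. u j * measure (\<xi> \<omega>) (A j)\<bar> \<partial>P) =
        (\<integral>\<^sup>+\<omega>. ennreal \<bar>\<Sum>j=1..n. u j * measure (\<xi> \<omega>) (B j)\<bar> \<partial>P)"
      \<comment> \<open>The factor \<open>1 / c\<close> depends neither on the sets nor on
        \<open>u\<close>, so it is the same on both sides.\<close>
      by (simp only: abs_mean[OF A] abs_mean[OF B])
  qed
  ultimately show ?thesis using prob by blast
qed

end
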